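(* Let $Q$ be a finite quandle such that the Schur multiplier $H^2(Inn(Q),\mathbb{C}^\times)$ is trivial. Let $\theta:Q\to Inn(Q)$, $x\mapsto L_x$. Then the irreducible representations of $Q$ over $\mathbb{C}$ are exactly the representations $\chi\cdot(\rho'\circ\theta)$, where $\rho'$ is an irreducible complex linear representation of the group $Inn(Q)$ and $\chi$ is a character of $Q$. That is, every such $\chi\cdot(\rho'\circ\theta)$ is an irreducible representation of $Q$, and every irreducible representation $\rho:Q\to GL(V)$ of $Q$ is equal to $\chi\cdot(\rho'\circ\theta)$ for some such $\rho':Inn(Q)\to GL(V)$ and $\chi$.
   Context: A quandle is a set $Q$ with a binary operation $\triangleright$ such that $x\triangleright x=x$; $x\triangleright(y\triangleright z)=(x\triangleright y)\triangleright(x\triangleright z)$; and for all $x,y\in Q$ there is a unique $z\in Q$ with $x\triangleright z=y$. For $x\in Q$, $L_x:Q\to Q$ is the bijection $L_x(y)=x\triangleright y$; $Inn(Q)$ is the subgroup of the group of bijections of $Q$ generated by all $L_x$, $x\in Q$. A (linear) representation of $Q$ on a complex vector space $V$ is a map $\rho:Q\to GL(V)$ with $\rho(x\triangleright y)=\rho(x)\rho(y)\rho(x)^{-1}$ for all $x,y\in Q$. A subrepresentation is a subspace $W\subset V$ with $\rho(x)(W)\subset W$ for all $x\in Q$; $\rho$ is irreducible if $V\neq 0$ and its only subrepresentations are $0$ and $V$. A character of $Q$ is a map $\chi:Q\to\mathbb{C}^\times$ with $\chi(x\triangleright y)=\chi(y)$ for all $x,y\in Q$. For a representation $\rho$ of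 $Q$, $(\chi\cdot\rho)(x)=\chi(x)\rho(x)$. $H^2(G,\mathbb{C}^\times)$ denotes group cohomology with trivial action on $\mathbb{C}^\times$. *)

theory Defs
  imports Complex_Main "HOL-Algebra.Bij" "HOL-Algebra.Coset" "HOL-Algebra.Product_Groups"
begin

section \<open>Quandles and their inner automorphism groups\<close>

locale quandle =
  fixes Q :: "'a set" and tri :: "'a \<Rightarrow> 'a \<Rightarrow> 'a" (infixr \<open>\<triangleright>\<close> 70)
  assumes closed: "x \<in> Q \<Longrightarrow> y \<in> Q \<Longrightarrow> x \<triangleright> y \<in> Q"
    and idem: "x \<in> Q \<Longrightarrow> x \<triangleright> x = x"
    and distrib: "x \<in> Q \<Longrightarrow> y \<in> Q \<Longrightarrow> z \<in> Q \<Longrightarrow> x \<triangleright> (y \<triangleright> z) = (x \<triangleright> y) \<triangleright> (x \<triangleright> z)"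
    and ex1_solution: "x \<in> Q \<Longrightarrow> y \<in> Q \<Longrightarrow> \<exists>!z. z \<in> Q \<and> x \<triangleright> z = y"

text \<open>The map \<open>x \<mapsto> L\<^sub>x\<close>. Elements of \<^const>\<open>BijGroup\<close> are extensional functions, hence the
  restriction to \<open>Q\<close>.\<close>

definition left_mult :: "'a set \<Rightarrow> ('a \<Rightarrow> 'a \<Rightarrow> 'a) \<Rightarrow> 'a \<Rightarrow> 'a \<Rightarrow> 'a"
  where "left_mult Q tri x = (\<lambda>y\<in>Q. tri x y)"

definition Inn :: "'a set \<Rightarrow> ('a \<Rightarrow> 'a \<Rightarrow> 'a) \<Rightarrow> ('a \<Rightarrow> 'a) monoid"
  where "Inn Q tri = subgroup_generated (BijGroup Q) (left_mult Q tri ` Q)"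

lemma (in quandle) left_mult_in_Bij:
  assumes "x \<in> Q" shows "left_mult Q (\<triangleright>) x \<in> carrier (BijGroup Q)"
proof -
  have "bij_betw ((\<triangleright>) x) Q Q"
    unfolding bij_betw_def inj_on_def using closed ex1_solution assms by (auto simp: image_iff) metis+
  then have "bij_betw (left_mult Q (\<triangleright>) x) Q Q"
    by (subst bij_betw_cong[where g = "(\<triangleright>) x"]) (auto simp: left_mult_def)
  then show ?thesis
    by (simp add: BijGroup_def Bij_def left_mult_def)
qed

lemma group_Inn: "group (Inn Q tri)"
  unfolding Inn_def by (rule group.group_subgroup_generated[OF group_BijGroup])

lemma (in quandle) left_mult_in_Inn: "x \<in> Q \<Longrightarrow> left_mult Q (\<triangleright>) x \<in> carrier (Inn Q (\<triangleright>))"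
  unfolding Inn_def carrier_subgroup_generated
  using left_mult_in_Bij by (auto intro: generate.incl)

section \<open>Representations\<close>

text \<open>A complex vector space is a type \<open>'v\<close> with a scalar multiplication \<open>scale\<close> satisfying
  \<^term>\<open>vector_space scale\<close>; no dimension restriction is made.\<close>

definition GL :: "(complex \<Rightarrow> 'v \<Rightarrow> 'v) \<Rightarrow> ('v::ab_group_add \<Rightarrow> 'v) monoid"
  where "GL scale =
    \<lparr>carrier = {f. Vector_Spaces.linear scale scale f \<and> bij f}, mult = (\<circ>), one = id\<rparr>"

lemma group_GL:
  assumes "vector_space scale" shows "group (GL scale)"
proof -
  interpret vector_space scale by fact
  show ?thesis
  proof (rule groupI)
    fix f assume "f \<in> carrier (GL scale)"
    then have f: "Vector_Spaces.linear scale scale f" "bij f" by (auto simp: GL_def)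
    interpret f: Vector_Spaces.linear scale scale f by fact
    have "Vector_Spaces.linear scale scale (inv_into UNIV f)"
      by unfold_locales (auto simp: f.add f.scale bij_inv_eq_iff[OF f(2)] bij_is_surj[OF f(2)] surj_f_inv_f
          intro!: inv_f_eq bij_is_inj[OF f(2)])
    with f show "\<exists>g\<in>carrier (GL scale). g \<otimes>\<^bsub>GL scale\<^esub> f = \<one>\<^bsub>GL scale\<^esub>"
      by (intro bexI[of _ "inv_into UNIV f"]) (auto simp: GL_def bij_imp_bij_inv bij_is_inj)
  qed (auto simp: GL_def o_assoc bij_comp linear_id id_def[symmetric] intro: Vector_Spaces.linear_compose)
qed

definition invariant_subspace ::
    "'x set \<Rightarrow> (complex \<Rightarrow> 'v::ab_group_add \<Rightarrow> 'v) \<Rightarrow> ('x \<Rightarrow> 'v \<Rightarrow> 'v) \<Rightarrow> 'v set \<Rightarrow> bool"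
  where "invariant_subspace X scale \<rho> W \<longleftrightarrow>
    module.subspace scale W \<and> (\<forall>x\<in>X. \<rho> x ` W \<subseteq> W)"

definition irreducible_on ::
    "'x set \<Rightarrow> (complex \<Rightarrow> 'v::ab_group_add \<Rightarrow> 'v) \<Rightarrow> ('x \<Rightarrow> 'v \<Rightarrow> 'v) \<Rightarrow> bool"
  where "irreducible_on X scale \<rho> \<longleftrightarrow>
    (UNIV :: 'v set) \<noteq> {0} \<and> (\<forall>W. invariant_subspace X scale \<rho> W \<longrightarrow> W = {0} \<or> W = UNIV)"

definition quandle_rep ::
    "'a set \<Rightarrow> ('a \<Rightarrow> 'a \<Rightarrow> 'a) \<Rightarrow> (complex \<Rightarrow> 'v::ab_group_add \<Rightarrow> 'v) \<Rightarrow> ('a \<Rightarrow> 'v \<Rightarrow> 'v) \<Rightarrow> bool"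
  where "quandle_rep Q tri scale \<rho> \<longleftrightarrow>
    \<rho> \<in> Q \<rightarrow> carrier (GL scale) \<and>
    (\<forall>x\<in>Q. \<forall>y\<in>Q. \<rho> (tri x y) = \<rho> x \<otimes>\<^bsub>GL scale\<^esub> \<rho> y \<otimes>\<^bsub>GL scale\<^esub> inv\<^bsub>GL scale\<^esub> (\<rho> x))"

definition irreducible_quandle_rep ::
    "'a set \<Rightarrow> ('a \<Rightarrow> 'a \<Rightarrow> 'a) \<Rightarrow> (complex \<Rightarrow> 'v::ab_group_add \<Rightarrow> 'v) \<Rightarrow> ('a \<Rightarrow> 'v \<Rightarrow> 'v) \<Rightarrow> bool"
  where "irreducible_quandle_rep Q tri scale \<rho> \<longleftrightarrow>
    quandle_rep Q tri scale \<rho> \<and> irreducible_on Q scale \<rho>"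

definition irreducible_group_rep ::
    "('g, 'm) monoid_scheme \<Rightarrow> (complex \<Rightarrow> 'v::ab_group_add \<Rightarrow> 'v) \<Rightarrow> ('g \<Rightarrow> 'v \<Rightarrow> 'v) \<Rightarrow> bool"
  where "irreducible_group_rep G scale \<rho> \<longleftrightarrow>
    \<rho> \<in> hom G (GL scale) \<and> irreducible_on (carrier G) scale \<rho>"

definition quandle_character :: "'a set \<Rightarrow> ('a \<Rightarrow> 'a \<Rightarrow> 'a) \<Rightarrow> ('a \<Rightarrow> complex) \<Rightarrow> bool"
  where "quandle_character Q tri \<chi> \<longleftrightarrow>
    (\<forall>x\<in>Q. \<chi> x \<noteq> 0) \<and> (\<forall>x\<in>Q. \<forall>y\<in>Q. \<chi> (tri x y) = \<chi> y)"

definition twist ::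
    "(complex \<Rightarrow> 'v \<Rightarrow> 'v) \<Rightarrow> ('a \<Rightarrow> complex) \<Rightarrow> ('a \<Rightarrow> 'v \<Rightarrow> 'v) \<Rightarrow> 'a \<Rightarrow> 'v \<Rightarrow> 'v"
  where "twist scale \<chi> \<rho> x = (\<lambda>v. scale (\<chi> x) (\<rho> x v))"

section \<open>Second group cohomology with trivial action\<close>

text \<open>Inhomogeneous (bar) cochains in degrees 1 to 3, with values in an abelian group \<open>A\<close> written
  multiplicatively, on which \<open>G\<close> acts trivially. The cochains are not required to be normalized.\<close>

definition cochains1 :: "('g, 'm) monoid_scheme \<Rightarrow> ('c, 'n) monoid_scheme \<Rightarrow> ('g \<Rightarrow> 'c) monoid"
  where "cochains1 G A = product_group (carrier G) (\<lambda>_. A)"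

definition cochains2 ::
    "('g, 'm) monoid_scheme \<Rightarrow> ('c, 'n) monoid_scheme \<Rightarrow> ('g \<times> 'g \<Rightarrow> 'c) monoid"
  where "cochains2 G A = product_group (carrier G \<times> carrier G) (\<lambda>_. A)"

definition cochains3 ::
    "('g, 'm) monoid_scheme \<Rightarrow> ('c, 'n) monoid_scheme \<Rightarrow> ('g \<times> 'g \<times> 'g \<Rightarrow> 'c) monoid"
  where "cochains3 G A = product_group (carrier G \<times> carrier G \<times> carrier G) (\<lambda>_. A)"

definition coboundary1 ::
    "('g, 'm) monoid_scheme \<Rightarrow> ('c, 'n) monoid_scheme \<Rightarrow> ('g \<Rightarrow> 'c) \<Rightarrow> 'g \<times> 'g \<Rightarrow> 'c"
  where "coboundary1 G A c = (\<lambda>(g, h)\<in>carrier G \<times> carrier G.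
    c h \<otimes>\<^bsub>A\<^esub> inv\<^bsub>A\<^esub> c (g \<otimes>\<^bsub>G\<^esub> h) \<otimes>\<^bsub>A\<^esub> c g)"

definition coboundary2 ::
    "('g, 'm) monoid_scheme \<Rightarrow> ('c, 'n) monoid_scheme \<Rightarrow> ('g \<times> 'g \<Rightarrow> 'c) \<Rightarrow> 'g \<times> 'g \<times> 'g \<Rightarrow> 'c"
  where "coboundary2 G A f = (\<lambda>(g, h, k)\<in>carrier G \<times> carrier G \<times> carrier G.
    f (h, k) \<otimes>\<^bsub>A\<^esub> inv\<^bsub>A\<^esub> f (g \<otimes>\<^bsub>G\<^esub> h, k) \<otimes>\<^bsub>A\<^esub> f (g, h \<otimes>\<^bsub>G\<^esub> k) \<otimes>\<^bsub>A\<^esub> inv\<^bsub>A\<^esub> f (g, h))"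

definition cocycles2 ::
    "('g, 'm) monoid_scheme \<Rightarrow> ('c, 'n) monoid_scheme \<Rightarrow> ('g \<times> 'g \<Rightarrow> 'c) monoid"
  where "cocycles2 G A = (cochains2 G A)
    \<lparr>carrier := kernel (cochains2 G A) (cochains3 G A) (coboundary2 G A)\<rparr>"

definition H2 ::
    "('g, 'm) monoid_scheme \<Rightarrow> ('c, 'n) monoid_scheme \<Rightarrow> ('g \<times> 'g \<Rightarrow> 'c) set monoid"
  where "H2 G A = cocycles2 G A Mod (coboundary1 G A ` carrier (cochains1 G A))"

lemma (in comm_group) coboundary_cancel:
  assumes [simp]: "g \<in> carrier G" "h \<in> carrier G" "k \<in> carrier G" "p \<in> carrier G" "q \<in> carrier G" "r \<in> carrier G"
  shows "(k \<otimes> inv p \<otimes> h) \<otimes> inv (k \<otimes> inv q \<otimes> r) \<otimes> (p \<otimes> inv q \<otimes> g) \<otimes> inv (h \<otimes> inv r \<otimes> g) = \<one>"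
proof -
  have "(k \<otimes> inv p \<otimes> h) \<otimes> inv (k \<otimes> inv q \<otimes> r) \<otimes> (p \<otimes> inv q \<otimes> g) \<otimes> inv (h \<otimes> inv r \<otimes> g)
    = (k \<otimes> inv k) \<otimes> (p \<otimes> inv p) \<otimes> (h \<otimes> inv h) \<otimes> (q \<otimes> inv q) \<otimes> (r \<otimes> inv r) \<otimes> (g \<otimes> inv g)"
    by (simp add: inv_mult m_ac del: r_inv l_inv Units_r_inv Units_l_inv)
  then show ?thesis by simp
qed

lemma group_H2:
  assumes "group G" "comm_group A"
  shows "group (H2 G A)"
proof -
  interpret G: group G by fact
  interpret A: comm_group A by fact
  let ?C1 = "cochains1 G A" and ?C2 = "cochains2 G A" and ?C3 = "cochains3 G A"
  have C1: "group ?C1" and C2: "group ?C2" and C3: "group ?C3"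
    by (simp_all add: cochains1_def cochains2_def cochains3_def A.is_group)
  have comm: "comm_group ?C2"
    by (intro group.group_comm_groupI C2)
      (auto simp: cochains2_def product_group_def PiE_iff A.m_comm intro!: restrict_ext)
  have d1: "coboundary1 G A \<in> hom ?C1 ?C2"
    by (rule homI) (auto simp: coboundary1_def cochains1_def cochains2_def product_group_def PiE_iff
        A.inv_mult A.m_ac fun_eq_iff intro!: restrict_ext)
  have d2: "coboundary2 G A \<in> hom ?C2 ?C3"
    by (rule homI) (auto simp: coboundary2_def cochains2_def cochains3_def product_group_def PiE_iff
        A.inv_mult A.m_ac fun_eq_iff intro!: restrict_ext)
  interpret d1: group_hom ?C1 ?C2 "coboundary1 G A"
    using C1 C2 d1 by (simp add: group_hom_def group_hom_axioms_def)
  interpret d2: group_hom ?C2 ?C3 "coboundary2 G A"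
    using C2 C3 d2 by (simp add: group_hom_def group_hom_axioms_def)
  have "coboundary2 G A (coboundary1 G A c) = \<one>\<^bsub>?C3\<^esub>" if c: "c \<in> carrier ?C1" for c
  proof -
    have [simp]: "c g \<in> carrier A" if "g \<in> carrier G" for g
      using c that by (auto simp: cochains1_def product_group_def)
    show ?thesis
      by (auto simp: coboundary1_def coboundary2_def cochains3_def product_group_def G.m_assoc
          A.coboundary_cancel intro!: restrict_ext)
  qed
  then have sub: "coboundary1 G A ` carrier ?C1 \<subseteq> kernel ?C2 ?C3 (coboundary2 G A)"
    using d1.hom_closed by (auto simp: kernel_def)
  have Z: "comm_group (cocycles2 G A)"
    unfolding cocycles2_def
    using subgroup.subgroup_is_group[OF d2.subgroup_kernel C2]
    by (rule group.group_comm_groupI) (auto simp: kernel_def intro: comm_groupE(4)[OF comm])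
  have "subgroup (coboundary1 G A ` carrier ?C1) (cocycles2 G A)"
    unfolding cocycles2_def
    by (rule group.subgroup_incl[OF C2 d1.img_is_subgroup d2.subgroup_kernel sub])
  then have "coboundary1 G A ` carrier ?C1 \<lhd> cocycles2 G A"
    using Z by (simp add: comm_group.subgroup_imp_normal)
  then show ?thesis
    unfolding H2_def by (rule normal.factorgroup_is_group)
qed

definition complex_units :: "complex monoid"
  where "complex_units = \<lparr>carrier = UNIV - {0}, mult = (*), one = 1\<rparr>"

lemma comm_group_complex_units: "comm_group complex_units"
  by (rule comm_groupI) (auto simp: complex_units_def intro: exI[of _ "inverse _"] left_inverse)

end

theory Submission
  imports
    Defs
    "HOL-Algebra.Multiplicative_Group"
    "HOL-Computational_Algebra.Fundamental_Theorem_Algebra"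
    "HOL-Analysis.Continuum_Not_Denumerable"
begin

text \<open>
  Write \<open>G\<close> for the inner automorphism group of \<open>Q\<close>.
  Given a quandle representation \<open>\<rho>\<close> on \<open>V\<close>, every \<open>g \<in> G\<close> is \<^emph>\<open>implemented\<close> by an
  invertible operator \<open>R\<close>, in the sense that \<open>R \<rho>(y) = \<rho>(g y) R\<close> for all \<open>y \<in> Q\<close>: for \<open>g = L\<^sub>x\<close> the operator
  \<open>\<rho>(x)\<close> does this, and products and inverses of implementing operators implement products and
  inverses (\<open>ex_implements\<close>). If \<open>\<rho>\<close> is irreducible, then by Schur's lemma the implementing operator
  is unique up to a nonzero scalar (\<open>implements_unique\<close>). A choice \<open>R(g)\<close> of implementing operators
  is therefore a projective representation, \<open>R(g) R(h) = \<alpha>(g, h) R(g h)\<close>, whose factor set \<open>\<alpha>\<close> is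
  a 2-cocycle. As the Schur multiplier is trivial, \<open>\<alpha>\<close> is the coboundary of some \<open>c\<close>
  (\<open>factor_set_is_coboundary\<close>), and \<open>\<rho>'(g) = c(g)\<^sup>-\<^sup>1 R(g)\<close> is a linear representation
  of \<open>G\<close>. Both \<open>\<rho>(x)\<close> and \<open>\<rho>'(L\<^sub>x)\<close> implement \<open>L\<^sub>x\<close>, so they differ by a scalar \<open>\<chi>(x)\<close>; comparing the
  two sides of \<open>\<rho>(x \<triangleright> y) = \<rho>(x) \<rho>(y) \<rho>(x)\<^sup>-\<^sup>1\<close> shows that \<open>\<chi>\<close> is a character.

  Since \<open>V\<close> is not assumed finite dimensional, Schur's lemma needs an argument of Dixmier. An
  irreducible family of countably many operators acts on a space of countable dimension. If \<open>T\<close> commutes with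
  the family and no \<open>T - \<lambda>\<close> vanishes, then every \<open>T - \<lambda>\<close> is bijective, and for \<open>v \<noteq> 0\<close> the
  uncountably many vectors \<open>(T - \<lambda>)\<^sup>-\<^sup>1 v\<close> are linearly independent, which is impossible
  (\<open>Schur_countable\<close>).

  Conversely, if \<open>Q\<close> is finite, \<open>x \<mapsto> \<chi>(x) \<rho>'(L\<^sub>x)\<close> has the same invariant subspaces as \<open>\<rho>'\<close>, because
  the operators \<open>\<rho>'(L\<^sub>x)\<close> already generate the finite group \<open>\<rho>'(G)\<close> under multiplication alone
  (\<open>irreducible_twist\<close>).
\<close>

section \<open>Schur's lemma in countable dimension\<close>

text \<open>A type \<open>'v\<close> with a complex scalar multiplication, of arbitrary dimension.\<close>

locale complex_vector_space = vector_space scale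
  for scale :: "complex \<Rightarrow> 'v::ab_group_add \<Rightarrow> 'v" (infixr \<open>*s\<close> 75)
begin

lemma linear_iff:
  "Vector_Spaces.linear scale scale T \<longleftrightarrow>
    (\<forall>v w. T (v + w) = T v + T w) \<and> (\<forall>a v. T (a *s v) = a *s T v)"
  by (auto simp: module_hom_iff_linear[symmetric] module_hom_iff module_axioms)

text \<open>The operator \<open>p(T)\<close> obtained by substituting \<open>T\<close> into the polynomial \<open>p\<close>, evaluated by Horner's
  scheme.\<close>

definition poly_op :: "('v \<Rightarrow> 'v) \<Rightarrow> complex poly \<Rightarrow> 'v \<Rightarrow> 'v"
  where "poly_op T p = fold_coeffs (\<lambda>a f v. a *s v + T (f v)) p (\<lambda>_. 0)"

lemma poly_op_0 [simp]: "poly_op T 0 v = 0"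
  by (simp add: poly_op_def)

context
  fixes T :: "'v \<Rightarrow> 'v"
  assumes T: "Vector_Spaces.linear scale scale T"
begin

lemma add_T: "T (v + w) = T v + T w" and scale_T: "T (a *s v) = a *s T v"
  using T by (auto simp: linear_iff)

lemma zero_T: "T 0 = 0"
  using scale_T[of 0 0] by simp

lemma diff_T: "T (v - w) = T v - T w"
  using add_T[of "v - w" w] by (simp add: algebra_simps)

lemma poly_op_pCons [simp]: "poly_op T (pCons a p) v = a *s v + T (poly_op T p v)"
  by (cases "p = 0 \<and> a = 0") (auto simp: poly_op_def zero_T)

lemma poly_op_add: "poly_op T (p + q) v = poly_op T p v + poly_op T q v"
  by (induction p q rule: poly_induct2) (simp_all add: add_T scale_left_distrib algebra_simps)

lemma poly_op_smult: "poly_op T (smult a p) v = a *s poly_op T p v"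
  by (induction p) (simp_all add: scale_T scale_right_distrib)

lemma poly_op_sum: "poly_op T (\<Sum>i\<in>F. p i) v = (\<Sum>i\<in>F. poly_op T (p i) v)"
  by (induction F rule: infinite_finite_induct) (simp_all add: poly_op_add)

lemma poly_op_add_arg: "poly_op T p (v + w) = poly_op T p v + poly_op T p w"
  by (induction p) (simp_all add: add_T scale_right_distrib add_ac)

lemma poly_op_diff_arg: "poly_op T p (v - w) = poly_op T p v - poly_op T p w"
  using poly_op_add_arg[of p "v - w" w] by (simp add: algebra_simps)

lemma poly_op_sum_arg: "poly_op T p (\<Sum>i\<in>F. v i) = (\<Sum>i\<in>F. poly_op T p (v i))"
  using poly_op_diff_arg[of p 0 0]
  by (induction F rule: infinite_finite_induct) (simp_all add: poly_op_add_arg)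

lemma poly_op_scale_arg: "poly_op T p (a *s v) = a *s poly_op T p v"
  by (induction p) (simp_all add: scale_T scale_right_distrib mult.commute)

lemma poly_op_commute: "poly_op T p (T v) = T (poly_op T p v)"
  by (induction p) (simp_all add: scale_T add_T zero_T)

lemma poly_op_mult_linear_factor:
  "poly_op T ([:- l, 1:] * p) v = poly_op T p (T v - l *s v)"
proof -
  have "[:- l, 1:] * p = smult (- l) p + pCons 0 p"
    by simp
  then show ?thesis
    by (simp only: poly_op_add poly_op_smult poly_op_diff_arg poly_op_scale_arg poly_op_commute
        poly_op_pCons) simp
qed

text \<open>Since polynomials over \<open>\<complex>\<close> split into linear factors, \<open>p(T)\<close> is injective as soon as no \<open>T - l\<close>
  has a kernel.\<close>

lemma poly_op_injective:
  assumes no_eigenvector: "\<And>l v. T v = l *s v \<Longrightarrow> v = 0"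
    and "p \<noteq> 0" and "poly_op T p v = 0"
  shows "v = 0"
  using assms(2,3)
proof (induction "degree p" arbitrary: p v)
  case 0
  then obtain a where "p = [:a:]" using degree_eq_zeroE[of p] by metis
  with 0 show ?case by (simp add: zero_T)
next
  case (Suc n)
  have "\<not> (\<exists>a l. a \<noteq> 0 \<and> l = 0 \<and> p = pCons a l)"
    using Suc.hyps(2) by auto
  then obtain l where "poly p l = 0"
    using fundamental_theorem_of_algebra_alt by blast
  then obtain q where q: "p = [:- l, 1:] * q"
    unfolding poly_eq_0_iff_dvd by (rule dvdE)
  with Suc.prems have "q \<noteq> 0" by auto
  then have "degree p = degree [:- l, 1:] + degree q"
    unfolding q by (intro degree_mult_eq) auto
  then have "n = degree q"
    using Suc.hyps(2) by simp
  moreover have "poly_op T q (T v - l *s v) = 0"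
    using Suc.prems(2) unfolding q poly_op_mult_linear_factor .
  ultimately have "T v - l *s v = 0"
    by (rule Suc.hyps(1)[OF _ \<open>q \<noteq> 0\<close>])
  then show ?case
    by (intro no_eigenvector[of v l]) simp
qed

text \<open>Here \<open>u l\<close> plays the role of \<open>(T - l)\<^sup>-\<^sup>1 v\<close>. A linear relation among these vectors, multiplied by
  all factors \<open>T - l\<close> that occur in it, becomes a polynomial relation \<open>p(T) v = 0\<close>.\<close>

lemma resolvent_vectors_relation:
  assumes no_eigenvector: "\<And>l v. T v = l *s v \<Longrightarrow> v = 0"
    and "v \<noteq> 0" and u: "\<And>l. T (u l) - l *s u l = v"
    and F: "finite F" and relation: "(\<Sum>l\<in>F. c l *s u l) = 0" and "m \<in> F"
  shows "c m = 0"
proof -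
  define P where "P l = (\<Prod>k\<in>F - {l}. [:- k, 1:])" for l
  define p where "p = (\<Sum>l\<in>F. smult (c l) (P l))"
  have "poly_op T (\<Prod>k\<in>F. [:- k, 1:]) (u l) = poly_op T (P l) v" if "l \<in> F" for l
    by (simp only: prod.remove[OF F that] poly_op_mult_linear_factor u P_def)
  then have "poly_op T p v = (\<Sum>l\<in>F. poly_op T (\<Prod>k\<in>F. [:- k, 1:]) (c l *s u l))"
    by (simp add: p_def poly_op_sum poly_op_smult poly_op_scale_arg)
  also have "\<dots> = poly_op T (\<Prod>k\<in>F. [:- k, 1:]) (\<Sum>l\<in>F. c l *s u l)"
    by (simp only: poly_op_sum_arg)
  also have "\<dots> = 0"
    using poly_op_diff_arg[of _ 0 0] by (simp add: relation)
  finally have "p = 0"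
    using poly_op_injective[of p v] no_eigenvector \<open>v \<noteq> 0\<close> by blast
  have "poly (P l) m = 0" if "l \<in> F" "l \<noteq> m" for l
    using that F \<open>m \<in> F\<close> by (simp add: P_def poly_prod)
  then have "(\<Sum>l\<in>F - {m}. c l * poly (P l) m) = 0"
    by (intro sum.neutral) simp
  then have "poly p m = c m * poly (P m) m"
    using sum.remove[OF F \<open>m \<in> F\<close>, of "\<lambda>l. c l * poly (P l) m"]
    by (simp add: p_def poly_sum poly_smult)
  moreover have "poly (P m) m \<noteq> 0"
    using F by (simp add: P_def poly_prod)
  ultimately show ?thesis
    using \<open>p = 0\<close> by simp
qed

end

lemma countable_independent:
  assumes B: "independent B" "B \<subseteq> span S" and S: "countable S"
  shows "countable B"
proof -
  have cover: "B \<subseteq> (\<Union>F\<in>{F. finite F \<and> F \<subseteq> S}. B \<inter> span F)"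
  proof
    fix b assume "b \<in> B"
    with B(2) obtain t r where "finite t" "t \<subseteq> S" "b = (\<Sum>a\<in>t. r a *s a)"
      unfolding span_explicit by blast
    then have "b \<in> span t"
      by (simp add: span_sum span_scale span_base)
    with \<open>b \<in> B\<close> \<open>finite t\<close> \<open>t \<subseteq> S\<close>
    show "b \<in> (\<Union>F\<in>{F. finite F \<and> F \<subseteq> S}. B \<inter> span F)" by blast
  qed
  have "countable (B \<inter> span F)" if "finite F" for F
  proof -
    have "independent (B \<inter> span F)"
      by (rule independent_mono[OF B(1)]) simp
    then show ?thesis
      using independent_span_bound[OF that] by (simp add: countable_finite)
  qed
  then have "countable (\<Union>F\<in>{F. finite F \<and> F \<subseteq> S}. B \<inter> span F)"
    by (intro countable_UN countable_Collect_finite_subset[OF S]) blast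
  with cover show ?thesis
    by (rule countable_subset)
qed

text \<open>A spanning set is the orbit of one nonzero vector under all words in the operators.\<close>

lemma irreducible_countable_span:
  assumes X: "countable X" and irr: "irreducible_on X scale \<rho>"
    and lin: "\<And>x. x \<in> X \<Longrightarrow> Vector_Spaces.linear scale scale (\<rho> x)"
  shows "\<exists>S. countable S \<and> span S = UNIV"
proof -
  obtain v :: 'v where "v \<noteq> 0"
    using irr by (auto simp: irreducible_on_def)
  define S where "S = (\<lambda>xs. foldr \<rho> xs v) ` lists X"
  have "invariant_subspace X scale \<rho> (span S)"
    unfolding invariant_subspace_def
  proof (intro conjI ballI)
    fix x assume x: "x \<in> X"
    interpret Vector_Spaces.linear scale scale "\<rho> x"
      using lin[OF x] .
    have "\<rho> x (foldr \<rho> xs v) \<in> S" if "xs \<in> lists X" for xs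
      unfolding S_def using that x by (auto intro!: image_eqI[of _ _ "x # xs"])
    then have "\<rho> x ` S \<subseteq> S"
      by (auto simp: S_def)
    then show "\<rho> x ` span S \<subseteq> span S"
      using span_mono by (simp add: span_image[symmetric])
  qed simp
  moreover have "v \<in> span S"
    by (rule span_base) (auto simp: S_def intro!: image_eqI[of _ _ "[]"])
  ultimately have "span S = UNIV"
    using irr \<open>v \<noteq> 0\<close> unfolding irreducible_on_def by blast
  moreover have "countable S"
    using X by (simp add: S_def)
  ultimately show ?thesis by blast
qed

theorem Schur_countable:
  assumes X: "countable X" and irr: "irreducible_on X scale \<rho>"
    and lin: "\<And>x. x \<in> X \<Longrightarrow> Vector_Spaces.linear scale scale (\<rho> x)"
    and T: "Vector_Spaces.linear scale scale T"
    and comm: "\<And>x v. x \<in> X \<Longrightarrow> T (\<rho> x v) = \<rho> x (T v)"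
  shows "\<exists>c. \<forall>v. T v = c *s v"
proof (rule ccontr)
  assume non_scalar: "\<nexists>c. \<forall>v. T v = c *s v"
  note T_simps = add_T[OF T] scale_T[OF T] zero_T[OF T]
  have \<rho>_simps: "\<rho> x (a + b) = \<rho> x a + \<rho> x b" "\<rho> x (k *s a) = k *s \<rho> x a"
    "\<rho> x (a - b) = \<rho> x a - \<rho> x b" if "x \<in> X" for x a b k
    using add_T[OF lin[OF that]] scale_T[OF lin[OF that]] diff_T[OF lin[OF that]] by auto
  obtain v :: 'v where v: "v \<noteq> 0"
    using irr by (auto simp: irreducible_on_def)
  \<comment> \<open>Kernel and range of \<open>T - l\<close> are invariant, so \<open>T - l\<close>, not being zero, is injective and
    surjective.\<close>
  have no_eigenvector: "w = 0" if "T w = l *s w" for l w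
  proof -
    have "invariant_subspace X scale \<rho> {w. T w = l *s w}"
      by (auto simp: invariant_subspace_def subspace_def T_simps scale_right_distrib \<rho>_simps comm
          mult.commute)
    then have "{w. T w = l *s w} = {0}"
      using irr non_scalar unfolding irreducible_on_def by blast
    with that show ?thesis by blast
  qed
  have surj: "\<exists>w. T w - l *s w = v" for l
  proof -
    let ?I = "range (\<lambda>w. T w - l *s w)"
    have "invariant_subspace X scale \<rho> ?I"
      unfolding invariant_subspace_def
    proof (intro conjI ballI subspaceI)
      show "0 \<in> ?I"
        by (rule range_eqI[of _ _ 0]) (simp add: T_simps)
    next
      fix a b assume "a \<in> ?I" "b \<in> ?I"
      then obtain a' b' where "a = T a' - l *s a'" "b = T b' - l *s b'" by blast
      then show "a + b \<in> ?I"
        by (intro range_eqI[of _ _ "a' + b'"]) (simp add: T_simps scale_right_distrib)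
    next
      fix k a assume "a \<in> ?I"
      then obtain a' where "a = T a' - l *s a'" by blast
      then show "k *s a \<in> ?I"
        by (intro range_eqI[of _ _ "k *s a'"])
          (simp add: T_simps scale_right_diff_distrib mult.commute)
    next
      fix x assume x: "x \<in> X"
      show "\<rho> x ` ?I \<subseteq> ?I"
      proof clarify
        fix w
        show "\<rho> x (T w - l *s w) \<in> ?I"
          by (rule range_eqI[of _ _ "\<rho> x w"]) (simp add: \<rho>_simps comm x)
      qed
    qed
    moreover have "?I \<noteq> {0}"
    proof
      assume "?I = {0}"
      then have "T v - l *s v = 0" by blast
      then show False
        using no_eigenvector[of v l] v by simp
    qed
    ultimately have "?I = UNIV"
      using irr unfolding irreducible_on_def by blast
    then have "v \<in> ?I" by simp
    then obtain w where "v = T w - l *s w" by (rule rangeE)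
    then show ?thesis by (intro exI[of _ w]) simp
  qed
  then obtain u where u: "\<And>l. T (u l) - l *s u l = v"
    by metis
  have relation: "c m = 0" if "finite F" "(\<Sum>l\<in>F. c l *s u l) = 0" "m \<in> F" for F c m
    by (rule resolvent_vectors_relation[OF T _ v u that]) (rule no_eigenvector)
  have "inj u"
  proof (rule injI)
    fix l k assume eq: "u l = u k"
    have "l *s u l = k *s u l"
      by (rule diff_left_imp_eq[of "T (u l)"]) (use u[of l] u[of k] eq in simp)
    moreover have "u l \<noteq> 0"
      using u[of l] v by (auto simp: T_simps)
    ultimately show "l = k" by simp
  qed
  have "independent (range u)"
    unfolding independent_explicit_module
  proof (intro allI impI)
    fix t g w
    assume t: "finite t" "t \<subseteq> range u" "(\<Sum>b\<in>t. g b *s b) = 0" "w \<in> t"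
    then obtain F where F: "finite F" "t = u ` F"
      using finite_subset_image[of t u UNIV] by blast
    then have "(\<Sum>l\<in>F. g (u l) *s u l) = 0"
      using t(3) sum.reindex[OF inj_on_subset[OF \<open>inj u\<close> subset_UNIV], of "\<lambda>b. g b *s b" F]
      by simp
    moreover obtain l where "l \<in> F" "w = u l"
      using t(4) F(2) by blast
    ultimately show "g w = 0"
      using relation[OF F(1), of "\<lambda>l. g (u l)" l] by simp
  qed
  moreover have "\<exists>S. countable S \<and> span S = UNIV"
    by (rule irreducible_countable_span[OF X irr]) (rule lin)
  ultimately have "countable (range u)"
    using countable_independent[of "range u"] by auto
  then show False
    using countable_image_inj_eq[OF \<open>inj u\<close>] uncountable_UNIV_complex by blast
qed

end

section \<open>Factor sets\<close>

text \<open>Triviality of \<open>H2\<close>, read off in terms of nonvanishing functions: the coset of a cocycle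
  coincides with the subgroup of coboundaries, so it consists of coboundaries.\<close>

lemma factor_set_is_coboundary:
  fixes G :: "('g, 'm) monoid_scheme" and \<alpha> :: "'g \<Rightarrow> 'g \<Rightarrow> complex"
  assumes "group G" and H2: "trivial_group (H2 G complex_units)"
    and nonzero: "\<And>g h. g \<in> carrier G \<Longrightarrow> h \<in> carrier G \<Longrightarrow> \<alpha> g h \<noteq> 0"
    and cocycle: "\<And>g h k. g \<in> carrier G \<Longrightarrow> h \<in> carrier G \<Longrightarrow> k \<in> carrier G \<Longrightarrow>
      \<alpha> h k * \<alpha> g (h \<otimes>\<^bsub>G\<^esub> k) = \<alpha> (g \<otimes>\<^bsub>G\<^esub> h) k * \<alpha> g h"
  shows "\<exists>c. (\<forall>g\<in>carrier G. c g \<noteq> 0) \<and>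
    (\<forall>g\<in>carrier G. \<forall>h\<in>carrier G. \<alpha> g h * c (g \<otimes>\<^bsub>G\<^esub> h) = c g * c h)"
proof -
  interpret G: group G by fact
  interpret U: comm_group complex_units by (rule comm_group_complex_units)
  have carrier_U: "a \<in> carrier complex_units \<longleftrightarrow> a \<noteq> 0" for a
    by (simp add: complex_units_def)
  have mult_U: "a \<otimes>\<^bsub>complex_units\<^esub> b = a * b" and one_U: "\<one>\<^bsub>complex_units\<^esub> = 1" for a b
    by (simp_all add: complex_units_def)
  have inv_U: "inv\<^bsub>complex_units\<^esub> a = inverse a" if "a \<noteq> 0" for a
    by (rule U.inv_equality) (use that in \<open>auto simp: mult_U one_U carrier_U\<close>)
  let ?B = "coboundary1 G complex_units ` carrier (cochains1 G complex_units)"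
  define f where "f = (\<lambda>(g, h)\<in>carrier G \<times> carrier G. \<alpha> g h)"
  have f2: "f \<in> carrier (cochains2 G complex_units)"
    by (auto simp: cochains2_def f_def carrier_U nonzero)
  have df: "coboundary2 G complex_units f = \<one>\<^bsub>cochains3 G complex_units\<^esub>"
    unfolding coboundary2_def cochains3_def product_group_def
  proof (simp, intro restrict_ext, clarify)
    fix g h k assume gh: "g \<in> carrier G" "h \<in> carrier G" "k \<in> carrier G"
    then show "f (h, k) \<otimes>\<^bsub>complex_units\<^esub> inv\<^bsub>complex_units\<^esub> f (g \<otimes>\<^bsub>G\<^esub> h, k) \<otimes>\<^bsub>complex_units\<^esub>
        f (g, h \<otimes>\<^bsub>G\<^esub> k) \<otimes>\<^bsub>complex_units\<^esub> inv\<^bsub>complex_units\<^esub> f (g, h) = \<one>\<^bsub>complex_units\<^esub>"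
      using cocycle[OF gh] by (simp add: f_def mult_U one_U inv_U nonzero field_simps)
  qed
  have f: "f \<in> carrier (cocycles2 G complex_units)"
    using f2 df by (simp add: cocycles2_def kernel_def)
  have "?B #>\<^bsub>cocycles2 G complex_units\<^esub> f \<in> carrier (H2 G complex_units)"
    using f by (auto simp: H2_def FactGroup_def RCOSETS_def)
  then have coset: "?B #>\<^bsub>cocycles2 G complex_units\<^esub> f = ?B"
    using H2 by (simp add: trivial_group_def H2_def FactGroup_def)
  \<comment> \<open>The coboundary of the constant cochain 1 is the unit, so \<open>f\<close> belongs to its own coset.\<close>
  define e where "e = (\<lambda>g\<in>carrier G. 1 :: complex)"
  have "e \<in> carrier (cochains1 G complex_units)"
    by (auto simp: e_def cochains1_def carrier_U)
  then have "coboundary1 G complex_units e \<in> ?B" by blast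
  moreover have "coboundary1 G complex_units e \<otimes>\<^bsub>cocycles2 G complex_units\<^esub> f = f"
    by (auto simp: coboundary1_def cocycles2_def cochains2_def product_group_def e_def f_def
        mult_U inv_U fun_eq_iff)
  ultimately have "f \<in> ?B #>\<^bsub>cocycles2 G complex_units\<^esub> f"
    unfolding r_coset_def by force
  then obtain c where c: "c \<in> carrier (cochains1 G complex_units)"
    and fc: "f = coboundary1 G complex_units c"
    unfolding coset by blast
  have c_nz: "c g \<noteq> 0" if "g \<in> carrier G" for g
    using c that by (auto simp: cochains1_def carrier_U)
  have "\<alpha> g h * c (g \<otimes>\<^bsub>G\<^esub> h) = c g * c h" if "g \<in> carrier G" "h \<in> carrier G" for g h
  proof -
    have "\<alpha> g h = coboundary1 G complex_units c (g, h)"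
      using that by (simp add: fc[symmetric] f_def)
    then show ?thesis
      using that by (simp add: coboundary1_def mult_U inv_U c_nz)
  qed
  with c_nz show ?thesis by blast
qed

section \<open>The inner automorphism group\<close>

lemma carrier_Inn_subset: "carrier (Inn Q tri) \<subseteq> Bij Q"
  using group.generate_incl[OF group_BijGroup, of "carrier (BijGroup Q) \<inter> left_mult Q tri ` Q" Q]
  by (auto simp: Inn_def carrier_subgroup_generated BijGroup_def)

lemma Inn_closed: "g \<in> carrier (Inn Q tri) \<Longrightarrow> y \<in> Q \<Longrightarrow> g y \<in> Q"
  using funcset_mem[OF Bij_imp_funcset] subsetD[OF carrier_Inn_subset] by metis

lemma mult_Inn:
  "g \<in> carrier (Inn Q tri) \<Longrightarrow> h \<in> carrier (Inn Q tri) \<Longrightarrow> g \<otimes>\<^bsub>Inn Q tri\<^esub> h = compose Q g h"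
  using subsetD[OF carrier_Inn_subset, of g Q tri] subsetD[OF carrier_Inn_subset, of h Q tri]
  by (simp add: Inn_def BijGroup_def)

lemma one_Inn: "\<one>\<^bsub>Inn Q tri\<^esub> = (\<lambda>x\<in>Q. x)"
  by (simp add: Inn_def BijGroup_def)

lemma finite_Inn: "finite Q \<Longrightarrow> finite (carrier (Inn Q tri))"
proof (rule finite_subset)
  show "carrier (Inn Q tri) \<subseteq> (Q \<rightarrow>\<^sub>E Q)"
  proof
    fix g assume "g \<in> carrier (Inn Q tri)"
    then have "g \<in> Bij Q"
      using carrier_Inn_subset by blast
    then show "g \<in> Q \<rightarrow>\<^sub>E Q"
      by (simp add: PiE_def Bij_imp_funcset Bij_imp_extensional)
  qed
qed (simp add: finite_PiE)

context quandle
begin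

text \<open>Induction over the inner automorphism group as the group generated by the left
  multiplications.\<close>

lemma Inn_induct [consumes 1, case_names one left_mult inv mult]:
  assumes g: "g \<in> carrier (Inn Q (\<triangleright>))"
    and one: "P \<one>\<^bsub>Inn Q (\<triangleright>)\<^esub>"
    and left_mult: "\<And>x. x \<in> Q \<Longrightarrow> P (left_mult Q (\<triangleright>) x)"
    and inv: "\<And>x. x \<in> Q \<Longrightarrow> P (inv\<^bsub>Inn Q (\<triangleright>)\<^esub> left_mult Q (\<triangleright>) x)"
    and mult: "\<And>g h. g \<in> carrier (Inn Q (\<triangleright>)) \<Longrightarrow> h \<in> carrier (Inn Q (\<triangleright>)) \<Longrightarrow> P g \<Longrightarrow> P h \<Longrightarrow>
      P (g \<otimes>\<^bsub>Inn Q (\<triangleright>)\<^esub> h)"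
  shows "P g"
proof -
  let ?S = "carrier (BijGroup Q) \<inter> left_mult Q (\<triangleright>) ` Q"
  have carrier: "carrier (Inn Q (\<triangleright>)) = generate (BijGroup Q) ?S"
    by (simp add: Inn_def carrier_subgroup_generated)
  have mult_eq: "g \<otimes>\<^bsub>Inn Q (\<triangleright>)\<^esub> h = g \<otimes>\<^bsub>BijGroup Q\<^esub> h" for g h
    by (simp add: Inn_def)
  have inv_eq: "inv\<^bsub>Inn Q (\<triangleright>)\<^esub> g = inv\<^bsub>BijGroup Q\<^esub> g" if "g \<in> carrier (Inn Q (\<triangleright>))" for g
    using that unfolding Inn_def by (rule group.inv_subgroup_generated[OF group_BijGroup])
  from g have "g \<in> generate (BijGroup Q) ?S"
    by (simp add: carrier)
  then show ?thesis
  proof (induction rule: generate.induct)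
    case one
    then show ?case using assms(2) by (simp add: Inn_def)
  next
    case (incl h)
    then show ?case using left_mult by blast
  next
    case (inv h)
    then obtain x where "x \<in> Q" "h = left_mult Q (\<triangleright>) x" by blast
    then show ?case
      using assms(4)[of x] inv_eq left_mult_in_Inn by simp
  next
    case (eng h1 h2)
    then show ?case using mult[of h1 h2] by (simp add: carrier mult_eq)
  qed
qed

lemma left_mult_conjugate:
  assumes "x \<in> Q" "y \<in> Q"
  shows "left_mult Q (\<triangleright>) (x \<triangleright> y) \<otimes>\<^bsub>Inn Q (\<triangleright>)\<^esub> left_mult Q (\<triangleright>) x =
    left_mult Q (\<triangleright>) x \<otimes>\<^bsub>Inn Q (\<triangleright>)\<^esub> left_mult Q (\<triangleright>) y"
  using assms
  by (simp add: mult_Inn left_mult_in_Inn closed)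
    (auto simp: compose_def left_mult_def closed distrib[symmetric])

end

section \<open>Twisting representations of the inner automorphism group\<close>

lemma carrier_GL: "f \<in> carrier (GL scale) \<longleftrightarrow> Vector_Spaces.linear scale scale f \<and> bij f"
  by (simp add: GL_def)

lemma mult_GL: "f \<otimes>\<^bsub>GL scale\<^esub> g = f \<circ> g"
  by (simp add: GL_def)

lemma one_GL: "\<one>\<^bsub>GL scale\<^esub> = id"
  by (simp add: GL_def)

context complex_vector_space
begin

lemma scale_in_GL:
  assumes "a \<noteq> 0" "f \<in> carrier (GL scale)"
  shows "(\<lambda>v. a *s f v) \<in> carrier (GL scale)"
proof -
  have f: "Vector_Spaces.linear scale scale f" "bij f"
    using assms by (simp_all add: carrier_GL)
  have "bij (\<lambda>v. a *s v)"
  proof (rule o_bij)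
    show "(\<lambda>v. inverse a *s v) \<circ> (\<lambda>v. a *s v) = id" "(\<lambda>v. a *s v) \<circ> (\<lambda>v. inverse a *s v) = id"
      using assms(1) by (simp_all add: fun_eq_iff)
  qed
  with f(2) have "bij ((\<lambda>v. a *s v) \<circ> f)"
    by (rule bij_comp)
  moreover have "Vector_Spaces.linear scale scale (\<lambda>v. a *s f v)"
    unfolding linear_iff
    using add_T[OF f(1)] scale_T[OF f(1)] by (simp add: scale_right_distrib mult.commute)
  ultimately show ?thesis
    by (simp add: carrier_GL comp_def)
qed

text \<open>The defining identity of a quandle representation, with the inverse cleared.\<close>

lemma quandle_rep_iff:
  assumes "quandle Q tri"
  shows "quandle_rep Q tri scale \<rho> \<longleftrightarrow> \<rho> \<in> Q \<rightarrow> carrier (GL scale) \<and>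
    (\<forall>x\<in>Q. \<forall>y\<in>Q. \<forall>v. \<rho> (tri x y) (\<rho> x v) = \<rho> x (\<rho> y v))"
proof -
  interpret GL: group "GL scale"
    by (rule group_GL) unfold_locales
  interpret quandle Q tri by fact
  have "\<rho> (tri x y) = \<rho> x \<otimes>\<^bsub>GL scale\<^esub> \<rho> y \<otimes>\<^bsub>GL scale\<^esub> inv\<^bsub>GL scale\<^esub> (\<rho> x) \<longleftrightarrow>
      (\<forall>v. \<rho> (tri x y) (\<rho> x v) = \<rho> x (\<rho> y v))"
    if \<rho>: "\<rho> \<in> Q \<rightarrow> carrier (GL scale)" and xy: "x \<in> Q" "y \<in> Q" for x y
  proof -
    have [simp]: "\<rho> x \<in> carrier (GL scale)" "\<rho> y \<in> carrier (GL scale)"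
      "\<rho> (tri x y) \<in> carrier (GL scale)"
      using \<rho> xy closed by auto
    have "\<rho> (tri x y) = \<rho> x \<otimes>\<^bsub>GL scale\<^esub> \<rho> y \<otimes>\<^bsub>GL scale\<^esub> inv\<^bsub>GL scale\<^esub> (\<rho> x) \<longleftrightarrow>
        \<rho> (tri x y) \<otimes>\<^bsub>GL scale\<^esub> \<rho> x = \<rho> x \<otimes>\<^bsub>GL scale\<^esub> \<rho> y"
      using GL.inv_solve_right[of "\<rho> (tri x y)" "\<rho> x \<otimes>\<^bsub>GL scale\<^esub> \<rho> y" "\<rho> x"] by auto
    then show ?thesis
      by (simp add: mult_GL fun_eq_iff)
  qed
  then show ?thesis
    unfolding quandle_rep_def by blast
qed

lemma hom_left_mult_conjugate:
  assumes "quandle Q tri" and \<rho>': "\<rho>' \<in> hom (Inn Q tri) (GL scale)" and xy: "x \<in> Q" "y \<in> Q"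
  shows "\<rho>' (left_mult Q tri (tri x y)) (\<rho>' (left_mult Q tri x) v) =
    \<rho>' (left_mult Q tri x) (\<rho>' (left_mult Q tri y) v)"
proof -
  interpret quandle Q tri by fact
  have "\<rho>' (left_mult Q tri (tri x y) \<otimes>\<^bsub>Inn Q tri\<^esub> left_mult Q tri x) =
      \<rho>' (left_mult Q tri x \<otimes>\<^bsub>Inn Q tri\<^esub> left_mult Q tri y)"
    by (simp only: left_mult_conjugate[OF xy])
  then show ?thesis
    using xy by (simp add: hom_mult[OF \<rho>'] left_mult_in_Inn closed mult_GL fun_eq_iff)
qed

text \<open>In a finite group the inverse of a left multiplication is one of its powers, so a subspace
  invariant under the left multiplications is invariant under the whole group.\<close>

lemma invariant_subspace_Inn:
  assumes Q: "quandle Q tri" "finite Q" and \<rho>': "\<rho>' \<in> hom (Inn Q tri) (GL scale)"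
    and W: "\<And>x. x \<in> Q \<Longrightarrow> \<rho>' (left_mult Q tri x) ` W \<subseteq> W"
    and g: "g \<in> carrier (Inn Q tri)"
  shows "\<rho>' g ` W \<subseteq> W"
proof -
  interpret quandle Q tri by fact
  interpret G: group "Inn Q tri" by (rule group_Inn)
  interpret GL: group "GL scale"
    by (rule group_GL) unfold_locales
  interpret \<rho>': group_hom "Inn Q tri" "GL scale" \<rho>'
    using \<rho>' by unfold_locales
  have mult: "\<rho>' (g \<otimes>\<^bsub>Inn Q tri\<^esub> h) ` W \<subseteq> W"
    if "g \<in> carrier (Inn Q tri)" "h \<in> carrier (Inn Q tri)" "\<rho>' g ` W \<subseteq> W" "\<rho>' h ` W \<subseteq> W" for g h
    using that by (auto simp: mult_GL image_subset_iff)
  have one: "\<rho>' \<one>\<^bsub>Inn Q tri\<^esub> ` W \<subseteq> W"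
    by (simp only: \<rho>'.hom_one one_GL) simp
  have pow: "\<rho>' (left_mult Q tri x [^]\<^bsub>Inn Q tri\<^esub> (n::nat)) ` W \<subseteq> W" if "x \<in> Q" for x n
    by (induction n) (use one mult W that left_mult_in_Inn in \<open>simp_all\<close>)
  from g show ?thesis
  proof (induction rule: Inn_induct)
    case (inv x)
    let ?L = "left_mult Q tri x" and ?n = "Coset.order (Inn Q tri)"
    have L: "?L \<in> carrier (Inn Q tri)"
      using inv by (rule left_mult_in_Inn)
    have "?n > 0"
      using finite_Inn[OF Q(2)] by (simp add: G.order_gt_0_iff_finite)
    then have "?L [^]\<^bsub>Inn Q tri\<^esub> (?n - 1) \<otimes>\<^bsub>Inn Q tri\<^esub> ?L = \<one>\<^bsub>Inn Q tri\<^esub>"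
      using L G.pow_order_eq_1[OF L] by (metis Suc_diff_1 G.nat_pow_Suc)
    then have "inv\<^bsub>Inn Q tri\<^esub> ?L = ?L [^]\<^bsub>Inn Q tri\<^esub> (?n - 1)"
      using L by (intro G.inv_equality) auto
    then show ?case
      using pow[OF inv] by simp
  qed (use one mult W in auto)
qed

lemma irreducible_twist:
  assumes Q: "quandle Q tri" "finite Q"
    and \<rho>': "irreducible_group_rep (Inn Q tri) scale \<rho>'"
    and \<chi>: "quandle_character Q tri \<chi>"
  shows "irreducible_quandle_rep Q tri scale (twist scale \<chi> (\<rho>' \<circ> left_mult Q tri))"
proof -
  interpret quandle Q tri by fact
  let ?L = "left_mult Q tri"
  have hom: "\<rho>' \<in> hom (Inn Q tri) (GL scale)" and irr: "irreducible_on (carrier (Inn Q tri)) scale \<rho>'"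
    using \<rho>' by (auto simp: irreducible_group_rep_def)
  have \<chi>_nz: "\<chi> x \<noteq> 0" if "x \<in> Q" for x
    using \<chi> that by (simp add: quandle_character_def)
  have GL: "\<rho>' (?L x) \<in> carrier (GL scale)" if "x \<in> Q" for x
    using hom left_mult_in_Inn[OF that] by (auto simp: hom_def)
  have scale_\<rho>': "\<rho>' (?L x) (a *s v) = a *s \<rho>' (?L x) v" if "x \<in> Q" for x a v
    using GL[OF that] by (simp add: carrier_GL linear_iff)
  have "quandle_rep Q tri scale (twist scale \<chi> (\<rho>' \<circ> ?L))"
    unfolding quandle_rep_iff[OF Q(1)]
  proof (intro conjI ballI allI)
    show "twist scale \<chi> (\<rho>' \<circ> ?L) \<in> Q \<rightarrow> carrier (GL scale)"
      using scale_in_GL[OF \<chi>_nz GL] by (auto simp: twist_def)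
  next
    fix x y v assume "x \<in> Q" "y \<in> Q"
    moreover have "\<chi> (tri x y) = \<chi> y"
      using \<chi> \<open>x \<in> Q\<close> \<open>y \<in> Q\<close> by (simp add: quandle_character_def)
    ultimately show "twist scale \<chi> (\<rho>' \<circ> ?L) (tri x y) (twist scale \<chi> (\<rho>' \<circ> ?L) x v) =
        twist scale \<chi> (\<rho>' \<circ> ?L) x (twist scale \<chi> (\<rho>' \<circ> ?L) y v)"
      by (simp add: twist_def scale_\<rho>' closed hom_left_mult_conjugate[OF Q(1) hom] mult.commute)
  qed
  moreover have "irreducible_on Q scale (twist scale \<chi> (\<rho>' \<circ> ?L))"
    unfolding irreducible_on_def
  proof (intro conjI allI impI)
    show "(UNIV :: 'v set) \<noteq> {0}"
      using irr by (simp add: irreducible_on_def)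
  next
    fix W assume W: "invariant_subspace Q scale (twist scale \<chi> (\<rho>' \<circ> ?L)) W"
    then have subW: "subspace W"
      by (simp add: invariant_subspace_def)
    have "\<rho>' (?L x) ` W \<subseteq> W" if x: "x \<in> Q" for x
    proof clarify
      fix w assume "w \<in> W"
      then have "\<chi> x *s \<rho>' (?L x) w \<in> W"
        using W x by (auto simp: invariant_subspace_def twist_def)
      then have "inverse (\<chi> x) *s (\<chi> x *s \<rho>' (?L x) w) \<in> W"
        by (rule subspace_scale[OF subW])
      then show "\<rho>' (?L x) w \<in> W"
        using \<chi>_nz[OF x] by simp
    qed
    then have "invariant_subspace (carrier (Inn Q tri)) scale \<rho>' W"
      using subW invariant_subspace_Inn[OF Q hom] by (simp add: invariant_subspace_def)
    with irr show "W = {0} \<or> W = UNIV"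
      by (simp add: irreducible_on_def)
  qed
  ultimately show ?thesis
    by (simp add: irreducible_quandle_rep_def)
qed

section \<open>Operators implementing inner automorphisms\<close>

text \<open>\<open>R\<close> implements the permutation \<open>g\<close> of \<open>Q\<close> if conjugation by \<open>R\<close> carries each \<open>\<rho> y\<close> to
  \<open>\<rho> (g y)\<close>.\<close>

definition implements :: "'a set \<Rightarrow> ('a \<Rightarrow> 'v \<Rightarrow> 'v) \<Rightarrow> ('a \<Rightarrow> 'a) \<Rightarrow> ('v \<Rightarrow> 'v) \<Rightarrow> bool"
  where "implements Q \<rho> g R \<longleftrightarrow>
    R \<in> carrier (GL scale) \<and> (\<forall>y\<in>Q. \<forall>v. R (\<rho> y v) = \<rho> (g y) (R v))"

lemma implements_compose:
  assumes "implements Q \<rho> g R" "implements Q \<rho> h S" "\<And>y. y \<in> Q \<Longrightarrow> h y \<in> Q"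
  shows "implements Q \<rho> (compose Q g h) (R \<circ> S)"
proof -
  interpret GL: group "GL scale"
    by (rule group_GL) unfold_locales
  have "R \<otimes>\<^bsub>GL scale\<^esub> S \<in> carrier (GL scale)"
    using assms by (auto simp: implements_def)
  then show ?thesis
    using assms by (auto simp: implements_def compose_def mult_GL)
qed

lemma implements_scale:
  assumes "implements Q \<rho> g R" "a \<noteq> 0" "\<And>y. y \<in> Q \<Longrightarrow> g y \<in> Q" "\<rho> \<in> Q \<rightarrow> carrier (GL scale)"
  shows "implements Q \<rho> g (\<lambda>v. a *s R v)"
proof -
  have "\<rho> (g y) (a *s v) = a *s \<rho> (g y) v" if "y \<in> Q" for y v
    using assms(3)[OF that] assms(4) by (auto simp: carrier_GL linear_iff Pi_iff)
  then show ?thesis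
    using assms(1,2) scale_in_GL[of a R] by (simp add: implements_def)
qed

lemma implements_left_mult:
  assumes "quandle Q tri" "quandle_rep Q tri scale \<rho>" "x \<in> Q"
  shows "implements Q \<rho> (left_mult Q tri x) (\<rho> x)"
  using assms by (auto simp: implements_def quandle_rep_iff left_mult_def)

lemma ex_implements:
  assumes Q: "quandle Q tri" and \<rho>: "quandle_rep Q tri scale \<rho>" and g: "g \<in> carrier (Inn Q tri)"
  shows "\<exists>R. implements Q \<rho> g R"
proof -
  interpret quandle Q tri by fact
  interpret G: group "Inn Q tri" by (rule group_Inn)
  interpret GL: group "GL scale"
    by (rule group_GL) unfold_locales
  from g show ?thesis
  proof (induction rule: Inn_induct)
    case one
    have "implements Q \<rho> \<one>\<^bsub>Inn Q tri\<^esub> id"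
      using GL.one_closed by (simp add: implements_def one_Inn one_GL)
    then show ?case by blast
  next
    case (left_mult x)
    then show ?case
      using implements_left_mult[OF Q \<rho>] by blast
  next
    case (inv x)
    let ?L = "left_mult Q tri x"
    have L: "?L \<in> carrier (Inn Q tri)"
      using inv by (rule left_mult_in_Inn)
    define h where "h = inv\<^bsub>Inn Q tri\<^esub> ?L"
    have h: "h \<in> carrier (Inn Q tri)"
      using L by (simp add: h_def)
    have Lh: "?L (h y) = y" if "y \<in> Q" for y
    proof -
      have "compose Q ?L h = (\<lambda>x\<in>Q. x)"
        using G.r_inv[OF L] L h by (simp add: mult_Inn one_Inn h_def)
      from fun_cong[OF this, of y] that show ?thesis
        by (simp add: compose_def)
    qed
    have R: "implements Q \<rho> ?L (\<rho> x)"
      by (rule implements_left_mult[OF Q \<rho> inv])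
    then have GL_R: "\<rho> x \<in> carrier (GL scale)"
      by (simp add: implements_def)
    define S where "S = inv\<^bsub>GL scale\<^esub> \<rho> x"
    have SR: "S (\<rho> x v) = v" and RS: "\<rho> x (S v) = v" for v
      using GL.l_inv[OF GL_R] GL.r_inv[OF GL_R]
      by (simp_all add: S_def mult_GL one_GL fun_eq_iff)
    have "S (\<rho> y v) = \<rho> (h y) (S v)" if "y \<in> Q" for y v
    proof -
      have "\<rho> x (\<rho> (h y) (S v)) = \<rho> y v"
        using R Inn_closed[OF h that] by (simp add: implements_def Lh[OF that] RS)
      then show ?thesis by (metis SR)
    qed
    then have "implements Q \<rho> h S"
      using GL_R by (simp add: implements_def S_def)
    then show ?case
      by (auto simp: h_def)
  next
    case (mult g h)
    then obtain R S where RS: "implements Q \<rho> g R" "implements Q \<rho> h S" by blast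
    from implements_compose[OF RS Inn_closed[OF mult(2)]] show ?case
      using mult(1,2) by (auto simp: mult_Inn)
  qed
qed

lemma implements_unique:
  assumes Q: "countable Q" and irr: "irreducible_on Q scale \<rho>" and \<rho>: "\<rho> \<in> Q \<rightarrow> carrier (GL scale)"
    and R: "implements Q \<rho> g R" and S: "implements Q \<rho> g S"
  shows "\<exists>c. c \<noteq> 0 \<and> (\<forall>v. R v = c *s S v)"
proof -
  interpret GL: group "GL scale"
    by (rule group_GL) unfold_locales
  have GL_R: "R \<in> carrier (GL scale)" and GL_S: "S \<in> carrier (GL scale)"
    using R S by (simp_all add: implements_def)
  have SS: "S ((inv\<^bsub>GL scale\<^esub> S) v) = v" "(inv\<^bsub>GL scale\<^esub> S) (S v) = v" for v
    using GL.r_inv[OF GL_S] GL.l_inv[OF GL_S] by (simp_all add: mult_GL one_GL fun_eq_iff)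
  define T where "T = inv\<^bsub>GL scale\<^esub> S \<circ> R"
  have "inv\<^bsub>GL scale\<^esub> S \<otimes>\<^bsub>GL scale\<^esub> R \<in> carrier (GL scale)"
    using GL_R GL_S by simp
  then have "Vector_Spaces.linear scale scale T"
    by (simp add: T_def mult_GL carrier_GL)
  moreover have "T (\<rho> y v) = \<rho> y (T v)" if "y \<in> Q" for y v
  proof -
    have "S (T (\<rho> y v)) = S (\<rho> y (T v))"
      using R S that by (simp add: implements_def T_def SS)
    then show ?thesis by (metis SS(2))
  qed
  moreover have "Vector_Spaces.linear scale scale (\<rho> x)" if "x \<in> Q" for x
    using \<rho> that by (auto simp: carrier_GL Pi_iff)
  ultimately have "\<exists>c. \<forall>v. T v = c *s v"
    by (intro Schur_countable[OF Q irr, of T])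
  then obtain c where c: "\<And>v. T v = c *s v"
    by blast
  have RS: "R v = c *s S v" for v
  proof -
    have "R v = S (T v)" by (simp add: T_def SS)
    also have "\<dots> = c *s S v"
      using GL_S by (simp add: c carrier_GL linear_iff)
    finally show ?thesis .
  qed
  obtain v :: 'v where "v \<noteq> 0"
    using irr by (auto simp: irreducible_on_def)
  have "c \<noteq> 0"
  proof
    assume "c = 0"
    then have "R v = R 0" by (simp add: RS)
    moreover have "inj R"
      using GL_R by (simp add: carrier_GL bij_is_inj)
    ultimately show False
      using \<open>v \<noteq> 0\<close> by (simp add: inj_eq)
  qed
  with RS show ?thesis by blast
qed

text \<open>The projective representation formed by the implementing operators can be rescaled to a
  linear one when the Schur multiplier vanishes.\<close>

lemma ex_linear_implementation:
  assumes Q: "quandle Q tri" "countable Q" and H2: "trivial_group (H2 (Inn Q tri) complex_units)"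
    and \<rho>: "irreducible_quandle_rep Q tri scale \<rho>"
  shows "\<exists>\<rho>'\<in>hom (Inn Q tri) (GL scale). \<forall>g\<in>carrier (Inn Q tri). implements Q \<rho> g (\<rho>' g)"
proof -
  let ?G = "Inn Q tri"
  interpret G: group ?G by (rule group_Inn)
  have rep: "quandle_rep Q tri scale \<rho>" and irr: "irreducible_on Q scale \<rho>"
    using \<rho> by (auto simp: irreducible_quandle_rep_def)
  have \<rho>_GL: "\<rho> \<in> Q \<rightarrow> carrier (GL scale)"
    using rep by (simp add: quandle_rep_def)
  obtain v :: 'v where v: "v \<noteq> 0"
    using irr by (auto simp: irreducible_on_def)
  obtain R where R: "\<And>g. g \<in> carrier ?G \<Longrightarrow> implements Q \<rho> g (R g)"
    using ex_implements[OF Q(1) rep] by metis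
  have R_scale: "R g (a *s w) = a *s R g w" if "g \<in> carrier ?G" for g a w
    using R[OF that] by (simp add: implements_def carrier_GL linear_iff)
  have R_nz: "R g v \<noteq> 0" if "g \<in> carrier ?G" for g
  proof -
    have "inj (R g)" "R g 0 = 0"
      using R[OF that] R_scale[OF that, of 0 0] by (auto simp: implements_def carrier_GL bij_is_inj)
    then show ?thesis using v by (metis injD)
  qed
  have "\<exists>a. a \<noteq> 0 \<and> (\<forall>w. R g (R h w) = a *s R (g \<otimes>\<^bsub>?G\<^esub> h) w)"
    if gh: "g \<in> carrier ?G" "h \<in> carrier ?G" for g h
  proof -
    have "implements Q \<rho> (g \<otimes>\<^bsub>?G\<^esub> h) (R g \<circ> R h)"
      using implements_compose[OF R[OF gh(1)] R[OF gh(2)] Inn_closed[OF gh(2)]] mult_Inn[OF gh]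
      by simp
    from implements_unique[OF Q(2) irr \<rho>_GL this R] gh show ?thesis by auto
  qed
  then obtain \<alpha> where \<alpha>: "\<And>g h. g \<in> carrier ?G \<Longrightarrow> h \<in> carrier ?G \<Longrightarrow> \<alpha> g h \<noteq> 0"
    and R_mult: "\<And>g h w. g \<in> carrier ?G \<Longrightarrow> h \<in> carrier ?G \<Longrightarrow>
      R g (R h w) = \<alpha> g h *s R (g \<otimes>\<^bsub>?G\<^esub> h) w"
    by metis
  \<comment> \<open>The cocycle identity is the associativity of \<open>R g \<circ> R h \<circ> R k\<close>.\<close>
  have cocycle: "\<alpha> h k * \<alpha> g (h \<otimes>\<^bsub>?G\<^esub> k) = \<alpha> (g \<otimes>\<^bsub>?G\<^esub> h) k * \<alpha> g h"
    if gh: "g \<in> carrier ?G" "h \<in> carrier ?G" "k \<in> carrier ?G" for g h k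
  proof -
    have "(\<alpha> h k * \<alpha> g (h \<otimes>\<^bsub>?G\<^esub> k)) *s R (g \<otimes>\<^bsub>?G\<^esub> h \<otimes>\<^bsub>?G\<^esub> k) v = R g (R h (R k v))"
      using gh by (simp add: R_mult R_scale G.m_assoc)
    also have "\<dots> = (\<alpha> (g \<otimes>\<^bsub>?G\<^esub> h) k * \<alpha> g h) *s R (g \<otimes>\<^bsub>?G\<^esub> h \<otimes>\<^bsub>?G\<^esub> k) v"
      using gh by (simp add: R_mult[of g h] R_mult[of "g \<otimes>\<^bsub>?G\<^esub> h" k] mult.commute)
    finally show ?thesis
      using R_nz gh by (simp add: scale_right_imp_eq)
  qed
  have "\<exists>c. (\<forall>g\<in>carrier ?G. c g \<noteq> 0) \<and>
      (\<forall>g\<in>carrier ?G. \<forall>h\<in>carrier ?G. \<alpha> g h * c (g \<otimes>\<^bsub>?G\<^esub> h) = c g * c h)"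
    by (rule factor_set_is_coboundary[OF group_Inn H2]) (fact \<alpha>, fact cocycle)
  then obtain c where c: "\<And>g. g \<in> carrier ?G \<Longrightarrow> c g \<noteq> 0"
    and \<alpha>_c: "\<And>g h. g \<in> carrier ?G \<Longrightarrow> h \<in> carrier ?G \<Longrightarrow> \<alpha> g h * c (g \<otimes>\<^bsub>?G\<^esub> h) = c g * c h"
    by blast
  define \<rho>' where "\<rho>' g = (\<lambda>w. inverse (c g) *s R g w)" for g
  have impl: "implements Q \<rho> g (\<rho>' g)" if "g \<in> carrier ?G" for g
    unfolding \<rho>'_def
    by (rule implements_scale[OF R[OF that] _ Inn_closed[OF that] \<rho>_GL]) (simp add: c that)
  have "\<rho>' \<in> hom ?G (GL scale)"
  proof (rule homI)
    fix g assume "g \<in> carrier ?G"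
    then show "\<rho>' g \<in> carrier (GL scale)"
      using impl by (simp add: implements_def)
  next
    fix g h assume gh: "g \<in> carrier ?G" "h \<in> carrier ?G"
    then have "inverse (c (g \<otimes>\<^bsub>?G\<^esub> h)) = inverse (c g) * inverse (c h) * \<alpha> g h"
      using \<alpha>_c[OF gh] c[of g] c[of h] c[of "g \<otimes>\<^bsub>?G\<^esub> h"] by (simp add: field_simps)
    then show "\<rho>' (g \<otimes>\<^bsub>?G\<^esub> h) = \<rho>' g \<otimes>\<^bsub>GL scale\<^esub> \<rho>' h"
      using gh by (simp add: \<rho>'_def mult_GL fun_eq_iff R_scale R_mult)
  qed
  with impl show ?thesis by blast
qed

lemma irreducible_quandle_rep_is_twist:
  assumes Q: "quandle Q tri" "countable Q" and H2: "trivial_group (H2 (Inn Q tri) complex_units)"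
    and \<rho>: "irreducible_quandle_rep Q tri scale \<rho>"
  shows "\<exists>\<rho>' \<chi>. irreducible_group_rep (Inn Q tri) scale \<rho>' \<and> quandle_character Q tri \<chi> \<and>
    (\<forall>x\<in>Q. \<rho> x = twist scale \<chi> (\<rho>' \<circ> left_mult Q tri) x)"
proof -
  interpret quandle Q tri by fact
  let ?G = "Inn Q tri" and ?L = "left_mult Q tri"
  have rep: "quandle_rep Q tri scale \<rho>" and irr: "irreducible_on Q scale \<rho>"
    using \<rho> by (auto simp: irreducible_quandle_rep_def)
  have \<rho>_GL: "\<rho> \<in> Q \<rightarrow> carrier (GL scale)"
    using rep by (simp add: quandle_rep_def)
  obtain \<rho>' where hom: "\<rho>' \<in> hom ?G (GL scale)"
    and impl: "\<And>g. g \<in> carrier ?G \<Longrightarrow> implements Q \<rho> g (\<rho>' g)"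
    using ex_linear_implementation[OF Q H2 \<rho>] by blast
  have "\<exists>a. a \<noteq> 0 \<and> (\<forall>w. \<rho> x w = a *s \<rho>' (?L x) w)" if "x \<in> Q" for x
    by (rule implements_unique[OF Q(2) irr \<rho>_GL implements_left_mult[OF Q(1) rep that]
          impl[OF left_mult_in_Inn[OF that]]])
  then obtain \<chi> where \<chi>: "\<And>x. x \<in> Q \<Longrightarrow> \<chi> x \<noteq> 0"
    and \<rho>_\<chi>: "\<And>x w. x \<in> Q \<Longrightarrow> \<rho> x w = \<chi> x *s \<rho>' (?L x) w"
    by metis
  have "irreducible_on (carrier ?G) scale \<rho>'"
    unfolding irreducible_on_def
  proof (intro conjI allI impI)
    show "(UNIV :: 'v set) \<noteq> {0}"
      using irr by (simp add: irreducible_on_def)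
  next
    fix W assume W: "invariant_subspace (carrier ?G) scale \<rho>' W"
    have "\<rho> x w \<in> W" if "x \<in> Q" "w \<in> W" for x w
      using W left_mult_in_Inn[OF that(1)] that
      by (auto simp: invariant_subspace_def \<rho>_\<chi> intro!: subspace_scale)
    then have "invariant_subspace Q scale \<rho> W"
      using W by (auto simp: invariant_subspace_def)
    with irr show "W = {0} \<or> W = UNIV"
      by (simp add: irreducible_on_def)
  qed
  moreover have "quandle_character Q tri \<chi>"
    unfolding quandle_character_def
  proof (intro conjI ballI)
    fix x y assume xy: "x \<in> Q" "y \<in> Q"
    obtain v :: 'v where v: "v \<noteq> 0"
      using irr by (auto simp: irreducible_on_def)
    \<comment> \<open>\<open>\<rho>' (L\<^sub>x)\<close> implements \<open>L\<^sub>x\<close> both for \<open>\<rho>\<close> and for \<open>y \<mapsto> \<rho>' (L\<^sub>y)\<close>; the factors \<open>\<chi>\<close>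
      relating the two families therefore agree at \<open>y\<close> and \<open>x \<triangleright> y\<close>.\<close>
    define w where "w = \<rho>' (?L (tri x y)) (\<rho>' (?L x) v)"
    have conj: "\<rho>' (?L x) (\<rho>' (?L y) v) = w"
      by (simp add: w_def hom_left_mult_conjugate[OF Q(1) hom xy])
    have \<rho>'_props: "\<rho>' (?L z) (a *s u) = a *s \<rho>' (?L z) u" "inj (\<rho>' (?L z))" if "z \<in> Q" for z a u
      using hom left_mult_in_Inn[OF that] by (auto simp: hom_def carrier_GL linear_iff Pi_iff bij_is_inj)
    have "\<rho>' (?L x) (\<rho> y v) = \<rho> (tri x y) (\<rho>' (?L x) v)"
      using impl[OF left_mult_in_Inn[OF xy(1)]] xy by (simp add: implements_def left_mult_def)
    then have "\<chi> y *s w = \<chi> (tri x y) *s w"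
      using xy by (simp only: \<rho>_\<chi> closed \<rho>'_props(1) conj flip: w_def)
    moreover have "w \<noteq> 0"
    proof -
      have nz: "\<rho>' (?L z) u \<noteq> 0" if "z \<in> Q" "u \<noteq> 0" for z u
        using \<rho>'_props(1)[OF that(1), of 0 0] injD[OF \<rho>'_props(2)[OF that(1)], of u 0] that(2)
        by auto
      show ?thesis
        unfolding w_def using xy v by (intro nz closed)
    qed
    ultimately show "\<chi> (tri x y) = \<chi> y" by simp
  qed (rule \<chi>)
  moreover have "\<rho> x = twist scale \<chi> (\<rho>' \<circ> ?L) x" if "x \<in> Q" for x
    using \<rho>_\<chi>[OF that] by (simp add: twist_def fun_eq_iff)
  ultimately show ?thesis
    using hom unfolding irreducible_group_rep_def by blast
qed

end

theorem theorem2p10: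
  fixes Q :: "'a set"
    and tri :: "'a \<Rightarrow> 'a \<Rightarrow> 'a"
    and scale :: "complex \<Rightarrow> 'v::ab_group_add \<Rightarrow> 'v"
  assumes "quandle Q tri"
    and "finite Q"
    and "trivial_group (H2 (Inn Q tri) complex_units)"
    and "vector_space scale"
  shows "(\<forall>\<rho>' \<chi>. irreducible_group_rep (Inn Q tri) scale \<rho>' \<longrightarrow> quandle_character Q tri \<chi> \<longrightarrow>
            irreducible_quandle_rep Q tri scale (twist scale \<chi> (\<rho>' \<circ> left_mult Q tri))) \<and>
         (\<forall>\<rho>. irreducible_quandle_rep Q tri scale \<rho> \<longrightarrow>
            (\<exists>\<rho>' \<chi>. irreducible_group_rep (Inn Q tri) scale \<rho>' \<and> quandle_character Q tri \<chi> \<and>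
               (\<forall>x\<in>Q. \<rho> x = twist scale \<chi> (\<rho>' \<circ> left_mult Q tri) x)))"
proof -
  interpret complex_vector_space scale
    using assms(4) by (simp add: complex_vector_space_def)
  show ?thesis
    using irreducible_twist[OF assms(1,2)]
      irreducible_quandle_rep_is_twist[OF assms(1) countable_finite[OF assms(2)] assms(3)]
    by blast
qed

end
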